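(* Let $a_0,a_1,\ldots,a_{2n}$ be real scalars and let $A=(a_{i+j})_{i,j=0}^{n}$ be the associated $(n+1)\times(n+1)$ Hankel matrix. If $A$ is $TP$ (totally positive), then for every integer $k$ with $1\leq k\leq n$ the Dodgson condensation matrix $D_k(A)$ is a Hankel matrix and is $TP$.
   Context: A real matrix is called totally positive ($TP$) if all of its minors (of all orders) are positive. A Hankel matrix is a square matrix of the form $(b_{i+j})_{i,j=0}^{m}$ for some sequence of scalars $b_0,\ldots,b_{2m}$. Dodgson condensation matrices: for an $N\times N$ real matrix $A$ with entry $a_{i,j}$ in row $i$ and column $j$ ($1\le i,j\le N$), put $D_0(A)=A$, i.e. $M^{(0)}_{i,j}=a_{i,j}$. Let $D_1(A)=[M^{(1)}_{i,j}]$ be the $(N-1)\times(N-1)$ matrix with $M^{(1)}_{i,j}=a_{i,j}a_{i+1,j+1}-a_{i,j+1}a_{i+1,j}$. For $2\leq k\leq N-1$, let $D_k(A)=[M^{(k)}_{i,j}]$ be the $(N-k)\times(N-k)$ matrix with $$M^{(k)}_{i,j}=\frac{M^{(k-1)}_{i,j}M^{(k-1)}_{i+1,j+1}-M^{(k-1)}_{i,j+1}M^{(k-1)}_{i+1,j}}{M^{(k-2)}_{i+1,j+1}},\qquad i,j=1,\ldots,N-k.$$ Equivalently (whenever the denominators are nonzero), $M^{(k)}_{i,j}$ is the contiguous minor of $A$ of order $k+1$ in rows $i,\ldots,i+k$ and columns $j,\ldots,j+k$. Here $N=n+1$. *)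

theory Defs
  imports
    "Jordan_Normal_Form.Determinant"
    "Jordan_Normal_Form.DL_Submatrix"
begin

text \<open>Rows and columns are indexed from 0, as everywhere for the matrix type used here.\<close>

text \<open>Only the values \<open>b 0, \<dots>, b (2 * m)\<close> occur in \<open>hankel_mat m b\<close>, which is a square matrix
  of size \<open>m + 1\<close>.\<close>

definition hankel_mat :: "nat \<Rightarrow> (nat \<Rightarrow> real) \<Rightarrow> real mat" where
  "hankel_mat m b = mat (m + 1) (m + 1) (\<lambda>(i, j). b (i + j))"

definition is_hankel :: "real mat \<Rightarrow> bool" where
  "is_hankel B \<longleftrightarrow> (\<exists>m b. B = hankel_mat m b)"

text \<open>\<open>submatrix A I J\<close> keeps the rows in \<open>I\<close> and the columns in \<open>J\<close>, in increasing order, so its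
  determinants for \<open>card I = card J\<close> are exactly the minors of \<open>A\<close>.\<close>

definition totally_positive :: "real mat \<Rightarrow> bool" where
  "totally_positive A \<longleftrightarrow>
    (\<forall>I J. I \<subseteq> {..<dim_row A} \<and> J \<subseteq> {..<dim_col A} \<and> I \<noteq> {} \<and> card I = card J
       \<longrightarrow> det (submatrix A I J) > 0)"

text \<open>The \<open>k\<close>-th condensation matrix of an \<open>N \<times> N\<close> matrix is meant for \<open>k < N\<close>, and has size
  \<open>N - k\<close>. Division by a vanishing entry of the matrix two steps back gives 0 by the usual
  convention; this does not happen when the contiguous minors of \<open>A\<close> are nonzero.\<close>

fun dodgson :: "nat \<Rightarrow> real mat \<Rightarrow> real mat" where
  "dodgson 0 A = A"
| "dodgson (Suc 0) A = mat (dim_row A - 1) (dim_col A - 1)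
     (\<lambda>(i, j). A $$ (i, j) * A $$ (i + 1, j + 1) - A $$ (i, j + 1) * A $$ (i + 1, j))"
| "dodgson (Suc (Suc k)) A =
     (let M = dodgson (Suc k) A; L = dodgson k A
      in mat (dim_row A - (k + 2)) (dim_col A - (k + 2))
           (\<lambda>(i, j). (M $$ (i, j) * M $$ (i + 1, j + 1) - M $$ (i, j + 1) * M $$ (i + 1, j))
                      / L $$ (i + 1, j + 1)))"

end

theory Submission
  imports Defs "HOL-Library.FuncSet"
begin

text \<open>By the Desnanot--Jacobi identity the entries of \<open>D\<^sub>k(A)\<close> are the contiguous minors
  \<open>det (a\<^bsub>s+p+q\<^esub>)\<close> of order \<open>k + 1\<close> with \<open>s = i + j\<close>, so \<open>D\<^sub>k(A)\<close> is Hankel. By Fekete's criterion it is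
  enough that its contiguous minors are positive. Such a minor, starting at offset \<open>s\<close>, is a principal
  minor of the compound of the Hankel matrix \<open>(a\<^bsub>s+p+q\<^esub>)\<close>. The latter is positive
  definite because its leading principal minors are contiguous minors of \<open>A\<close>, and compounds of
  positive definite matrices are positive definite by Cauchy--Binet.\<close>

section \<open>Determinants of functions of two indices\<close>

text \<open>Entries are given by an index function, so that choosing rows and columns is plain
  composition with maps of indices. Values of \<open>F\<close> at indices \<open>m\<close> and above
  are irrelevant.\<close>

definition fdet :: "nat \<Rightarrow> (nat \<Rightarrow> nat \<Rightarrow> 'a :: comm_ring_1) \<Rightarrow> 'a" where
  "fdet m F = det (mat m m (\<lambda>(i, j). F i j))"

lemma fdet_cong:
  assumes "\<And>i j. i < m \<Longrightarrow> j < m \<Longrightarrow> F i j = G i j"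
  shows "fdet m F = fdet m G"
proof -
  have "mat m m (\<lambda>(i, j). F i j) = mat m m (\<lambda>(i, j). G i j)"
    using assms by (intro eq_matI) auto
  then show ?thesis by (simp add: fdet_def)
qed

lemma fdet_leibniz:
  "fdet m F = (\<Sum>p | p permutes {0..<m}. signof p * (\<Prod>i=0..<m. F i (p i)))"
  unfolding fdet_def by (subst det_def') (auto intro!: sum.cong prod.cong)

lemma fdet_0 [simp]: "fdet 0 F = 1"
  by (simp add: fdet_leibniz)

lemma fdet_transpose: "fdet m (\<lambda>i j. F j i) = fdet m F"
proof -
  have "mat m m (\<lambda>(i, j). F j i) = transpose_mat (mat m m (\<lambda>(i, j). F i j))"
    by (intro eq_matI) auto
  then show ?thesis by (simp add: fdet_def det_transpose[of _ m])
qed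

lemma fdet_row:
  assumes "s < Suc m"
  shows "fdet (Suc m) F =
    (\<Sum>q<Suc m. (-1) ^ (s + q) * F s q * fdet m (\<lambda>i j. F (insert_index s i) (insert_index q j)))"
proof -
  let ?A = "mat (Suc m) (Suc m) (\<lambda>(i, j). F i j)"
  have "fdet (Suc m) F = (\<Sum>q<Suc m. ?A $$ (s, q) * cofactor ?A s q)"
    unfolding fdet_def by (rule laplace_expansion_row) (use assms in auto)
  also have "\<dots> = (\<Sum>q<Suc m. (-1) ^ (s + q) * F s q *
      fdet m (\<lambda>i j. F (insert_index s i) (insert_index q j)))"
  proof (rule sum.cong[OF refl])
    fix q assume q: "q \<in> {..<Suc m}"
    have "mat_delete ?A s q = mat m m (\<lambda>(i, j). F (insert_index s i) (insert_index q j))"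
      by (rule eq_matI) (use assms q in \<open>auto simp: mat_delete_def insert_index_def\<close>)
    then show "?A $$ (s, q) * cofactor ?A s q = (-1) ^ (s + q) * F s q *
        fdet m (\<lambda>i j. F (insert_index s i) (insert_index q j))"
      using assms q by (simp add: cofactor_def fdet_def)
  qed
  finally show ?thesis .
qed

lemma fdet_col:
  assumes "s < Suc m"
  shows "fdet (Suc m) F =
    (\<Sum>p<Suc m. (-1) ^ (p + s) * F p s * fdet m (\<lambda>i j. F (insert_index p i) (insert_index s j)))"
proof -
  have "fdet (Suc m) F = fdet (Suc m) (\<lambda>i j. F j i)" by (rule fdet_transpose[symmetric])
  also have "\<dots> = (\<Sum>p<Suc m. (-1) ^ (p + s) * F p s *
      fdet m (\<lambda>i j. F (insert_index p i) (insert_index s j)))"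
    unfolding fdet_row[OF assms]
  proof (rule sum.cong[OF refl])
    fix p
    show "(-1) ^ (s + p) * F p s * fdet m (\<lambda>i j. F (insert_index p j) (insert_index s i)) =
        (-1) ^ (p + s) * F p s * fdet m (\<lambda>i j. F (insert_index p i) (insert_index s j))"
      using fdet_transpose[of m "\<lambda>i j. F (insert_index p i) (insert_index s j)"]
      by (simp add: add.commute)
  qed
  finally show ?thesis .
qed

lemma fdet_1 [simp]: "fdet (Suc 0) F = F 0 0"
  by (simp add: fdet_row[of 0])

lemma fdet_unit_row:
  assumes "s < Suc m" and "\<And>j. j < Suc m \<Longrightarrow> F s j = (if j = 0 then 1 else 0)"
  shows "fdet (Suc m) F = (-1) ^ s * fdet m (\<lambda>i j. F (insert_index s i) (Suc j))"
proof -
  have "fdet (Suc m) F = (\<Sum>q<Suc m. if q = 0 then (-1) ^ s * fdet m (\<lambda>i j. F (insert_index s i) (Suc j)) else 0)"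
    unfolding fdet_row[OF assms(1)] by (rule sum.cong) (auto simp: assms(2))
  then show ?thesis by simp
qed

lemma fdet_zero_row:
  assumes "s < m" and "\<And>j. j < m \<Longrightarrow> F s j = 0"
  shows "fdet m F = 0"
proof -
  obtain m' where "m = Suc m'" using assms(1) by (cases m) auto
  then show ?thesis using assms by (simp add: fdet_row[of s m'])
qed

lemma fdet_identical_rows:
  assumes "i \<noteq> i'" "i < m" "i' < m" and "\<And>j. j < m \<Longrightarrow> F i j = F i' j"
  shows "fdet m F = 0"
  unfolding fdet_def
  by (rule det_identical_rows[of _ m i i']) (use assms in auto)

lemma fdet_kernel:
  fixes F :: "nat \<Rightarrow> nat \<Rightarrow> 'a :: idom"
  assumes "j0 < m" "v j0 \<noteq> 0" and "\<And>i. i < m \<Longrightarrow> (\<Sum>j<m. F i j * v j) = 0"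
  shows "fdet m F = 0"
proof -
  have "vec m v \<noteq> 0\<^sub>v m"
    using assms(1,2) by (metis index_vec index_zero_vec(1))
  moreover have "mat m m (\<lambda>(i, j). F i j) *\<^sub>v vec m v = 0\<^sub>v m"
    by (rule eq_vecI) (use assms(3) in \<open>auto simp: scalar_prod_def atLeast0LessThan\<close>)
  ultimately show ?thesis
    unfolding fdet_def by (subst det_0_iff_vec_prod_zero[of _ m]) (auto intro!: exI[of _ "vec m v"])
qed

lemma fdet_lower_triangular:
  assumes "\<And>i j. i < j \<Longrightarrow> j < m \<Longrightarrow> F i j = 0"
  shows "fdet m F = (\<Prod>i<m. F i i)"
proof -
  let ?A = "mat m m (\<lambda>(i, j). F i j)"
  have "fdet m F = prod_list (diag_mat ?A)"
    unfolding fdet_def by (rule det_lower_triangular[of m]) (use assms in auto)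
  also have "\<dots> = (\<Prod>i<m. F i i)"
    unfolding prod_list_diag_prod by (rule prod.cong) auto
  finally show ?thesis .
qed

lemma fdet_permute_rows:
  assumes "p permutes {0..<m}"
  shows "fdet m (\<lambda>i. F (p i)) = signof p * fdet m F"
proof -
  have "p i < m" if "i < m" for i using assms that permutes_in_image[OF assms, of i] by auto
  then have "mat m m (\<lambda>(i, j). F (p i) j) =
      mat m m (\<lambda>(i, j). mat m m (\<lambda>(i, j). F i j) $$ (p i, j))"
    by (intro eq_matI) auto
  then show ?thesis
    unfolding fdet_def by (simp add: det_permute_rows[OF _ assms])
qed

section \<open>A three-term identity between minors\<close>

text \<open>A Pluecker relation among \<open>k + 3\<close> rows. Let \<open>c x\<close> be the
  determinant of order \<open>k + 1\<close> with top row \<open>x\<close> above the rows of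
  \<open>R\<close> other than 0, \<open>t\<close> and \<open>k + 2\<close>. Since \<open>c\<close>
  is linear in the first \<open>k + 1\<close> entries of \<open>x\<close>, bordering
  \<open>R\<close> by the column \<open>c (R p)\<close> gives a singular matrix. Expanding along
  that column leaves the terms \<open>p = 0\<close>, \<open>t\<close>, \<open>k + 2\<close>, as
  \<open>c\<close> vanishes on all other rows.\<close>

lemma fdet_three_term:
  fixes R :: "nat \<Rightarrow> nat \<Rightarrow> 'a :: idom"
  assumes "1 \<le> t" "t \<le> Suc k"
  shows "fdet (Suc k) (\<lambda>i. R (Suc i)) * fdet (Suc (Suc k)) (\<lambda>i. R (insert_index t i)) =
      fdet (Suc k) (\<lambda>i. R (insert_index t i)) * fdet (Suc (Suc k)) (\<lambda>i. R (Suc i))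
    + fdet (Suc k) (\<lambda>i. R (insert_index t (Suc i))) * fdet (Suc (Suc k)) R"
proof -
  obtain u where u: "t = Suc u" "u \<le> k" using assms by (cases t) auto
  \<comment> \<open>For \<open>i < k\<close> these are exactly the rows other than 0,
    \<open>t\<close> and \<open>k + 2\<close>.\<close>
  define I where "I i = R (insert_index t (Suc i))" for i
  define \<gamma> where "\<gamma> q = (-1) ^ q * fdet k (\<lambda>i j. I i (insert_index q j))" for q
  define c where "c x = (\<Sum>q<Suc k. x q * \<gamma> q)" for x
  \<comment> \<open>Moving the distinguished row from position \<open>s\<close> to the top costs the
    sign \<open>(-1) ^ s\<close>.\<close>
  have c: "fdet (Suc k) F = (-1) ^ s * c (F s)"
    if "s < Suc k" "\<And>i. i < k \<Longrightarrow> F (insert_index s i) = I i" for s F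
  proof -
    have "fdet k (\<lambda>i j. F (insert_index s i) (insert_index q j))
        = fdet k (\<lambda>i j. I i (insert_index q j))" for q
      by (rule fdet_cong) (simp add: that(2))
    then show ?thesis
      unfolding fdet_row[OF that(1)] c_def \<gamma>_def sum_distrib_left
      by (intro sum.cong refl) (simp add: power_add mult_ac)
  qed
  have c0: "fdet (Suc k) (\<lambda>i. R (insert_index t i)) = c (R 0)"
    using c[of 0 "\<lambda>i. R (insert_index t i)"] u by (simp add: I_def)
  have ck: "fdet (Suc k) (\<lambda>i. R (insert_index t (Suc i))) = (-1) ^ k * c (R (Suc (Suc k)))"
    using c[of k "\<lambda>i. R (insert_index t (Suc i))"] u by (simp add: I_def)
  have ct: "fdet (Suc k) (\<lambda>i. R (Suc i)) = (-1) ^ u * c (R t)"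
    using c[of u "\<lambda>i. R (Suc i)"] u by (simp add: I_def insert_index_def)
  \<comment> \<open>Such a row already occurs among the rows \<open>I\<close>, at position
    \<open>i0\<close>, so the determinant has two equal rows.\<close>
  have cz: "c (R p) = 0" if p: "p < Suc (Suc (Suc k))" "p \<notin> {0, t, Suc (Suc k)}" for p
  proof -
    define i0 where "i0 = (if p < t then p - 1 else p - 2)"
    have i0: "i0 < k" "I i0 = R p"
      using p u by (auto simp: i0_def I_def insert_index_def Suc_diff_Suc numeral_2_eq_2)
    define F where "F i = (if i = 0 then R p else I (i - 1))" for i
    have "fdet (Suc k) F = c (R p)"
      using c[of 0 F] by (simp add: F_def)
    moreover have "fdet (Suc k) F = 0"
      by (rule fdet_identical_rows[of 0 "Suc i0"]) (use i0 in \<open>auto simp: F_def\<close>)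
    ultimately show ?thesis by simp
  qed
  define B where "B p j = (if j < Suc (Suc k) then R p j else c (R p))" for p j
  have "fdet (Suc (Suc (Suc k))) B = 0"
  proof (rule fdet_kernel)
    show "Suc (Suc k) < Suc (Suc (Suc k))" by simp
    \<comment> \<open>The last column of \<open>B\<close> is the combination of its first
      \<open>k + 1\<close> columns with weights \<gamma>; column \<open>k + 1\<close> gets weight
      0.\<close>
    define v where "v j = (if j < Suc k then \<gamma> j else if j = Suc k then 0 else -1)" for j
    show "v (Suc (Suc k)) \<noteq> 0" by (simp add: v_def)
    show "(\<Sum>j<Suc (Suc (Suc k)). B i j * v j) = 0" for i
    proof -
      have "(\<Sum>j<Suc (Suc (Suc k)). B i j * v j) = (\<Sum>j<Suc k. B i j * v j) - c (R i)"
        by (subst sum.lessThan_Suc, subst sum.lessThan_Suc) (simp add: v_def B_def)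
      also have "(\<Sum>j<Suc k. B i j * v j) = c (R i)"
        unfolding c_def by (intro sum.cong) (auto simp: v_def B_def)
      finally show ?thesis by simp
    qed
  qed
  moreover have "fdet (Suc (Suc k)) (\<lambda>i j. B (insert_index p i) (insert_index (Suc (Suc k)) j))
      = fdet (Suc (Suc k)) (\<lambda>i. R (insert_index p i))" for p
    by (rule fdet_cong) (simp add: B_def)
  ultimately have "0 = (\<Sum>p<Suc (Suc (Suc k)). (-1) ^ (p + Suc (Suc k)) * c (R p) *
      fdet (Suc (Suc k)) (\<lambda>i. R (insert_index p i)))"
    by (simp add: fdet_col[of "Suc (Suc k)"] B_def del: sum.lessThan_Suc)
  also have "\<dots> = (\<Sum>p\<in>{0, t, Suc (Suc k)}. (-1) ^ (p + Suc (Suc k)) * c (R p) *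
      fdet (Suc (Suc k)) (\<lambda>i. R (insert_index p i)))"
    by (rule sum.mono_neutral_right) (use u cz in auto)
  also have "\<dots> = (-1) ^ k * (c (R 0) * fdet (Suc (Suc k)) (\<lambda>i. R (Suc i))
      - (-1) ^ u * c (R t) * fdet (Suc (Suc k)) (\<lambda>i. R (insert_index t i))
      + (-1) ^ k * c (R (Suc (Suc k))) * fdet (Suc (Suc k)) (\<lambda>i. R (insert_index (Suc (Suc k)) i)))"
    using u by (simp add: algebra_simps power_add)
  also have "fdet (Suc (Suc k)) (\<lambda>i. R (insert_index (Suc (Suc k)) i)) = fdet (Suc (Suc k)) R"
    by (rule fdet_cong) simp
  finally have "c (R 0) * fdet (Suc (Suc k)) (\<lambda>i. R (Suc i))
      - (-1) ^ u * c (R t) * fdet (Suc (Suc k)) (\<lambda>i. R (insert_index t i))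
      + (-1) ^ k * c (R (Suc (Suc k))) * fdet (Suc (Suc k)) R = 0"
    by simp
  then show ?thesis
    unfolding c0 ck ct by (simp add: algebra_simps)
qed

text \<open>This is the three-term identity at \<open>t = 1\<close> after inserting the first unit
  vector as a new row between rows 0 and 1 of \<open>F\<close>. A determinant containing that row
  loses it together with column 0.\<close>

lemma desnanot_jacobi:
  fixes F :: "nat \<Rightarrow> nat \<Rightarrow> 'a :: idom"
  shows "fdet k (\<lambda>i j. F (Suc i) (Suc j)) * fdet (Suc (Suc k)) F =
      fdet (Suc k) F * fdet (Suc k) (\<lambda>i j. F (Suc i) (Suc j))
    - fdet (Suc k) (\<lambda>i j. F i (Suc j)) * fdet (Suc k) (\<lambda>i j. F (Suc i) j)"
proof -
  define R where
    "R p = (if p = 0 then F 0 else if p = 1 then (\<lambda>j. if j = 0 then 1 else 0) else F (p - 1))" for p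
  have R1: "R (insert_index 1 i) = F i" for i
    by (cases i) (auto simp: R_def insert_index_def)
  have R2: "R (Suc (Suc i)) = F (Suc i)" for i
    by (simp add: R_def)
  have RS: "fdet (Suc m) (\<lambda>i. R (Suc i)) = fdet m (\<lambda>i j. F (Suc i) (Suc j))" for m
    by (subst fdet_unit_row[of 0]) (auto simp: R_def)
  have R: "fdet (Suc (Suc k)) R = - fdet (Suc k) (\<lambda>i j. F i (Suc j))"
    by (subst fdet_unit_row[of 1]) (simp_all add: R1[simplified], simp add: R_def)
  show ?thesis
    using fdet_three_term[of 1 k R] by (simp add: R1[simplified] R2 RS R algebra_simps)
qed

section \<open>Fekete's criterion\<close>

definition increasing :: "nat \<Rightarrow> nat \<Rightarrow> (nat \<Rightarrow> nat) \<Rightarrow> bool" where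
  "increasing m N f \<longleftrightarrow> (\<forall>i j. i < j \<longrightarrow> j < m \<longrightarrow> f i < f j) \<and> (\<forall>i<m. f i < N)"

text \<open>Induction on the spread \<open>f (Suc k) - f 0\<close>. If \<open>f\<close> skips an
  index, inserting it makes the three-term identity express the wanted minor, times a positive minor
  of order \<open>k + 1\<close>, through positive minors of order \<open>k + 1\<close> and minors of
  order \<open>k + 2\<close> with smaller spread. Only initial columns are used.\<close>

lemma fekete_step:
  fixes Y :: "nat \<Rightarrow> nat \<Rightarrow> real"
  assumes minors: "\<And>f. increasing (Suc k) N f \<Longrightarrow> fdet (Suc k) (\<lambda>i. Y (f i)) > 0"
    and contiguous: "\<And>s. s + Suc (Suc k) \<le> N \<Longrightarrow> fdet (Suc (Suc k)) (\<lambda>i. Y (s + i)) > 0"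
    and "increasing (Suc (Suc k)) N f"
  shows "fdet (Suc (Suc k)) (\<lambda>i. Y (f i)) > 0"
  using assms(3)
proof (induction "f (Suc k) - f 0" arbitrary: f rule: less_induct)
  case less
  have mono: "f i < f j" if "i < j" "j < Suc (Suc k)" for i j
    using less.prems that by (auto simp: increasing_def)
  have bound: "f i < N" if "i < Suc (Suc k)" for i
    using less.prems that by (auto simp: increasing_def)
  show ?case
  proof (cases "\<forall>u<Suc k. f (Suc u) = Suc (f u)")
    case True
    have f: "f i = f 0 + i" if "i < Suc (Suc k)" for i
      using that by (induction i) (use True in auto)
    have "fdet (Suc (Suc k)) (\<lambda>i. Y (f i)) = fdet (Suc (Suc k)) (\<lambda>i. Y (f 0 + i))"
      by (rule fdet_cong) (metis f)
    then show ?thesis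
      using contiguous[of "f 0"] bound[of "Suc k"] f[of "Suc k"] by simp
  next
    case False
    then obtain u where u: "u < Suc k" "Suc (f u) < f (Suc u)"
      using mono by (metis Suc_lessI Suc_mono lessI)
    \<comment> \<open>The skipped index \<open>f u + 1\<close> is inserted right after
      \<open>f u\<close>. It lies strictly between the extreme indices, so both ends of
      \<open>f\<close> remain the ends of \<open>R\<close>, and dropping either one reduces the
      spread.\<close>
    define R where
      "R i = (if i < Suc u then f i else if i = Suc u then Suc (f u) else f (i - 1))" for i
    have R_ins: "R (insert_index (Suc u) i) = f i" for i
      by (simp add: R_def insert_index_def)
    have R_mono: "R i < R j" if "i < j" "j < Suc (Suc (Suc k))" for i j
      using that
    proof (induction j)
      case (Suc j)
      have "R j < R (Suc j)"
      proof (cases "j \<le> u")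
        case True
        then show ?thesis using u mono[of j "Suc j"] by (auto simp: R_def)
      next
        case False
        then show ?thesis using u Suc.prems mono[of "j - 1" j] by (auto simp: R_def)
      qed
      then show ?case using Suc by (cases "i = j") auto
    qed simp
    have R_bound: "R i < N" if "i < Suc (Suc (Suc k))" for i
      using that u bound[of i] bound[of "i - 1"] bound[of "Suc u"] by (auto simp: R_def)
    have ends: "R 0 = f 0" "R (Suc (Suc k)) = f (Suc k)"
      using u by (auto simp: R_def)
    have "fdet (Suc k) (\<lambda>i. Y (R (Suc i))) > 0"
      by (rule minors) (auto simp: increasing_def intro!: R_mono R_bound)
    moreover have "fdet (Suc k) (\<lambda>i. Y (f i)) > 0"
      by (rule minors) (auto simp: increasing_def intro!: mono bound)
    moreover have "fdet (Suc k) (\<lambda>i. Y (f (Suc i))) > 0"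
      by (rule minors) (auto simp: increasing_def intro!: mono bound)
    moreover have "fdet (Suc (Suc k)) (\<lambda>i. Y (R (Suc i))) > 0"
    proof (rule less.hyps)
      show "R (Suc (Suc k)) - R (Suc 0) < f (Suc k) - f 0"
        using R_mono[of 0 "Suc 0"] R_mono[of "Suc 0" "Suc (Suc k)"] ends by simp
      show "increasing (Suc (Suc k)) N (\<lambda>i. R (Suc i))"
        by (auto simp: increasing_def intro!: R_mono R_bound)
    qed
    moreover have "fdet (Suc (Suc k)) (\<lambda>i. Y (R i)) > 0"
    proof (rule less.hyps)
      show "R (Suc k) - R 0 < f (Suc k) - f 0"
        using R_mono[of 0 "Suc k"] R_mono[of "Suc k" "Suc (Suc k)"] ends by simp
      show "increasing (Suc (Suc k)) N R"
        by (auto simp: increasing_def intro!: R_mono R_bound)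
    qed
    moreover have "fdet (Suc k) (\<lambda>i. Y (R (Suc i))) * fdet (Suc (Suc k)) (\<lambda>i. Y (f i)) =
        fdet (Suc k) (\<lambda>i. Y (f i)) * fdet (Suc (Suc k)) (\<lambda>i. Y (R (Suc i)))
      + fdet (Suc k) (\<lambda>i. Y (f (Suc i))) * fdet (Suc (Suc k)) (\<lambda>i. Y (R i))"
      using fdet_three_term[of "Suc u" k "\<lambda>i. Y (R i)"] u by (simp add: R_ins)
    ultimately show ?thesis
      by (metis add_pos_pos mult_pos_pos zero_less_mult_pos)
  qed
qed

text \<open>The rows become arbitrary while the columns stay initial. The bound \<open>M\<close> is
  there because, once the columns are shifted or restricted, positivity is known only up to the
  order that still fits.\<close>

lemma fekete_rows:
  fixes Y :: "nat \<Rightarrow> nat \<Rightarrow> real"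
  assumes "\<And>m s. m \<le> M \<Longrightarrow> s + m \<le> N \<Longrightarrow> fdet m (\<lambda>i. Y (s + i)) > 0"
    and "m \<le> M" "increasing m N f"
  shows "fdet m (\<lambda>i. Y (f i)) > 0"
  using assms(2,3)
proof (induction m arbitrary: f)
  case 0
  then show ?case by simp
next
  case (Suc m)
  show ?case
  proof (cases m)
    case 0
    then show ?thesis
      using assms(1)[of 1 "f 0"] Suc.prems by (simp add: increasing_def)
  next
    case (Suc k)
    show ?thesis
      unfolding Suc
    proof (rule fekete_step)
      show "fdet (Suc k) (\<lambda>i. Y (f i)) > 0" if "increasing (Suc k) N f" for f
        using Suc.IH[of f] Suc.prems that \<open>m = Suc k\<close> by simp
      show "fdet (Suc (Suc k)) (\<lambda>i. Y (s + i)) > 0" if "s + Suc (Suc k) \<le> N" for s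
        using assms(1)[of "Suc m" s] Suc.prems that \<open>m = Suc k\<close> by simp
      show "increasing (Suc (Suc k)) N f"
        using Suc.prems \<open>m = Suc k\<close> by simp
    qed
  qed
qed

text \<open>The row version is used twice: with contiguous columns it frees the rows, and on the
  transpose, with the rows already chosen by \<open>f\<close>, it frees the columns.\<close>

lemma fekete:
  fixes X :: "nat \<Rightarrow> nat \<Rightarrow> real"
  assumes pos: "\<And>m s t. s + m \<le> N \<Longrightarrow> t + m \<le> N' \<Longrightarrow> fdet m (\<lambda>i j. X (s + i) (t + j)) > 0"
    and f: "increasing m N f" and g: "increasing m N' g"
  shows "fdet m (\<lambda>i j. X (f i) (g j)) > 0"
proof -
  have "fdet m (\<lambda>i j. X (f j) (g i)) > 0"
  \<comment> \<open>The hypothesis to supply concerns initial segments of \<open>f\<close> against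
    contiguous columns, which is the row version for columns starting at \<open>s\<close>.\<close>
  proof (rule fekete_rows[where Y = "\<lambda>i j. X (f j) i" and M = m, OF _ order_refl g])
    fix l s assume l: "l \<le> m" "s + l \<le> N'"
    have "fdet l (\<lambda>i j. X (f i) (s + j)) > 0"
    proof (rule fekete_rows[where Y = "\<lambda>i j. X i (s + j)" and M = l and N = N, OF _ order_refl])
      show "fdet k (\<lambda>i j. X (r + i) (s + j)) > 0" if "k \<le> l" "r + k \<le> N" for k r
        by (rule pos) (use l that in auto)
      show "increasing l N f" using f l by (auto simp: increasing_def)
    qed
    then show "fdet l (\<lambda>i j. X (f j) (s + i)) > 0"
      using fdet_transpose[of l "\<lambda>i j. X (f i) (s + j)"] by simp
  qed
  then show ?thesis
    using fdet_transpose[of m "\<lambda>i j. X (f i) (g j)"] by simp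
qed

section \<open>Gram matrices and compounds\<close>

text \<open>The Cauchy--Binet formula, summed over all maps instead of the strictly increasing ones, so
  that every minor is counted \<open>fact r\<close> times and no order on \<open>S\<close> is needed.\<close>

lemma fact_mult_fdet_gram:
  fixes U V :: "nat \<Rightarrow> 'b \<Rightarrow> 'a :: {comm_ring_1, ring_char_0}"
  assumes "finite S"
  shows "fact r * fdet r (\<lambda>i j. \<Sum>\<phi>\<in>S. U i \<phi> * V j \<phi>) =
    (\<Sum>\<Phi>\<in>{0..<r} \<rightarrow>\<^sub>E S. fdet r (\<lambda>i j. U i (\<Phi> j)) * fdet r (\<lambda>i j. V i (\<Phi> j)))"
proof -
  let ?G = "fdet r (\<lambda>i j. \<Sum>\<phi>\<in>S. U i \<phi> * V j \<phi>)"
  let ?E = "{0..<r} \<rightarrow>\<^sub>E S"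
  let ?P = "{p. p permutes {0..<r}}"
  define dV where "dV \<Phi> = fdet r (\<lambda>i j. V j (\<Phi> i))" for \<Phi>
  have "?G = (\<Sum>p\<in>?P. signof p * (\<Sum>\<Phi>\<in>?E. \<Prod>i=0..<r. U i (\<Phi> i) * V (p i) (\<Phi> i)))"
    unfolding fdet_leibniz
    by (rule sum.cong[OF refl], subst prod_sum_PiE) (use assms in auto)
  also have "\<dots> = (\<Sum>\<Phi>\<in>?E. \<Sum>p\<in>?P. signof p * (\<Prod>i=0..<r. U i (\<Phi> i) * V (p i) (\<Phi> i)))"
    unfolding sum_distrib_left by (rule sum.swap)
  also have "\<dots> = (\<Sum>\<Phi>\<in>?E. (\<Prod>i=0..<r. U i (\<Phi> i)) * dV \<Phi>)"
    unfolding dV_def fdet_leibniz sum_distrib_left prod.distrib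
    by (intro sum.cong refl) (simp add: mult_ac)
  finally have G: "?G = (\<Sum>\<Phi>\<in>?E. (\<Prod>i=0..<r. U i (\<Phi> i)) * dV \<Phi>)" .
  \<comment> \<open>Replacing \<Phi> by its composition with \<tau> permutes the index set and
    multiplies \<open>dV\<close> by the sign of \<tau>. Summing over all \<tau> then turns the
    product of the \<open>U\<close> entries into a Leibniz expansion, and the left side into
    \<open>fact r\<close> copies of the Gram determinant.\<close>
  have twist: "?G = (\<Sum>\<Phi>\<in>?E. signof \<tau> * (\<Prod>i=0..<r. U i (\<Phi> (\<tau> i))) * dV \<Phi>)"
    if "\<tau> \<in> ?P" for \<tau>
  proof -
    have \<tau>: "\<tau> permutes {0..<r}" using that by simp
    \<comment> \<open>Extensionality survives because \<open>p\<close> fixes every index outside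
      \<open>{0..<r}\<close>.\<close>
    have in_E: "(\<lambda>i. \<Phi> (p i)) \<in> ?E" if "\<Phi> \<in> ?E" "p permutes {0..<r}" for \<Phi> p
      using that by (auto simp: PiE_iff extensional_def permutes_in_image permutes_not_in
          simp del: atLeastLessThan_iff)
    have "bij_betw (\<lambda>\<Phi> i. \<Phi> (\<tau> i)) ?E ?E"
      by (rule bij_betw_byWitness[where f' = "\<lambda>\<Phi> i. \<Phi> (Hilbert_Choice.inv \<tau> i)"])
        (use in_E \<tau> permutes_inv[OF \<tau>] in \<open>auto simp: permutes_inverses[OF \<tau>]\<close>)
    then have "?G = (\<Sum>\<Phi>\<in>?E. (\<Prod>i=0..<r. U i (\<Phi> (\<tau> i))) * dV (\<lambda>i. \<Phi> (\<tau> i)))"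
      unfolding G by (rule sum.reindex_bij_betw[symmetric])
    moreover have "dV (\<lambda>i. \<Phi> (\<tau> i)) = signof \<tau> * dV \<Phi>" for \<Phi>
      unfolding dV_def by (rule fdet_permute_rows[OF \<tau>, of "\<lambda>i j. V j (\<Phi> i)"])
    ultimately show ?thesis by (simp add: mult_ac)
  qed
  have "card ?P = fact r" by (rule card_permutations) auto
  then have "fact r * ?G = (\<Sum>\<tau>\<in>?P. ?G)" by simp
  also have "\<dots> = (\<Sum>\<tau>\<in>?P. \<Sum>\<Phi>\<in>?E. signof \<tau> * (\<Prod>i=0..<r. U i (\<Phi> (\<tau> i))) * dV \<Phi>)"
    by (rule sum.cong[OF refl twist])
  also have "\<dots> = (\<Sum>\<Phi>\<in>?E. fdet r (\<lambda>i j. U i (\<Phi> j)) * dV \<Phi>)"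
    unfolding fdet_leibniz[of r "\<lambda>i j. U i (_ j)"] sum_distrib_right by (rule sum.swap)
  also have "\<dots> = (\<Sum>\<Phi>\<in>?E. fdet r (\<lambda>i j. U i (\<Phi> j)) * fdet r (\<lambda>i j. V i (\<Phi> j)))"
    unfolding dV_def by (intro sum.cong refl arg_cong2[where f = "(*)"] fdet_transpose)
  finally show ?thesis .
qed

text \<open>For \<open>V = U\<close> Cauchy--Binet gives a sum of squares, so one nonzero minor
  suffices.\<close>

lemma fdet_gram_pos:
  fixes U :: "nat \<Rightarrow> 'b \<Rightarrow> real"
  assumes "finite S" "\<Phi> \<in> {0..<r} \<rightarrow>\<^sub>E S" "fdet r (\<lambda>i j. U i (\<Phi> j)) \<noteq> 0"
  shows "fdet r (\<lambda>i j. \<Sum>\<phi>\<in>S. U i \<phi> * U j \<phi>) > 0"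
proof -
  have "(\<Sum>\<Phi>\<in>{0..<r} \<rightarrow>\<^sub>E S. fdet r (\<lambda>i j. U i (\<Phi> j)) * fdet r (\<lambda>i j. U i (\<Phi> j))) > 0"
    by (rule sum_pos2[OF _ assms(2)])
      (use assms in \<open>auto intro!: finite_PiE simp: zero_less_mult_iff\<close>)
  then have "fact r * fdet r (\<lambda>i j. \<Sum>\<phi>\<in>S. U i \<phi> * U j \<phi>) > 0"
    by (simp add: fact_mult_fdet_gram[OF assms(1)])
  then show ?thesis by (simp add: zero_less_mult_iff)
qed

section \<open>Schur complements and the Cholesky factorization\<close>

text \<open>One step of Gaussian elimination: \<open>A\<close> factors as \<open>E\<close> times
  \<open>B\<close>, where \<open>E\<close> is unit lower triangular and column 0 of \<open>B\<close>
  vanishes below \<open>A 0 0\<close>.\<close>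

lemma fdet_schur:
  fixes A :: "nat \<Rightarrow> nat \<Rightarrow> 'a :: field"
  assumes "A 0 0 \<noteq> 0"
  shows "fdet (Suc m) A = A 0 0 * fdet m (\<lambda>i j. A (Suc i) (Suc j) - A (Suc i) 0 * A 0 (Suc j) / A 0 0)"
proof -
  let ?n = "Suc m"
  define E where "E i j = (if i = j then 1 else if j = 0 then A i 0 / A 0 0 else 0)" for i j
  define B where "B i j = (if i = 0 then A 0 j else A i j - A i 0 * A 0 j / A 0 0)" for i j
  let ?M = "\<lambda>F. mat ?n ?n (\<lambda>(i, j). F i j)"
  have "(\<Sum>l<?n. E i l * B l j) = A i j" if "i < ?n" for i j
  proof (cases i)
    case 0
    then show ?thesis by (subst sum.lessThan_Suc_shift) (simp add: E_def B_def)
  next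
    case (Suc i')
    have "(\<Sum>l<?n. E i l * B l j) = A i 0 / A 0 0 * A 0 j + (\<Sum>l<m. E i (Suc l) * B (Suc l) j)"
      using Suc by (subst sum.lessThan_Suc_shift) (simp add: E_def B_def)
    also have "(\<Sum>l<m. E i (Suc l) * B (Suc l) j) = (\<Sum>l<m. if l = i' then B (Suc l) j else 0)"
      by (rule sum.cong) (auto simp: E_def Suc)
    also have "\<dots> = B i j" using that Suc by simp
    finally show ?thesis using Suc by (simp add: B_def)
  qed
  then have "?M A = ?M E * ?M B"
    by (intro eq_matI) (auto simp: scalar_prod_def atLeast0LessThan)
  then have "fdet ?n A = fdet ?n E * fdet ?n B"
    unfolding fdet_def by (simp add: det_mult[of _ ?n])
  also have "fdet ?n E = 1"
    by (subst fdet_lower_triangular) (auto simp: E_def)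
  also have "fdet ?n B = (\<Sum>p<?n. if p = 0 then A 0 0 * fdet m (\<lambda>i j. B (Suc i) (Suc j)) else 0)"
    unfolding fdet_col[OF zero_less_Suc] by (rule sum.cong) (use assms in \<open>auto simp: B_def\<close>)
  finally show ?thesis by (simp add: B_def)
qed

text \<open>Induction through the Schur complement of \<open>A 0 0\<close>. Its leading principal
  minors are those of \<open>A\<close> of one order more, divided by \<open>A 0 0\<close>, hence
  positive.\<close>

lemma cholesky:
  fixes A :: "nat \<Rightarrow> nat \<Rightarrow> real"
  assumes "\<And>i j. i < N \<Longrightarrow> j < N \<Longrightarrow> A i j = A j i"
    and "\<And>m. m \<le> N \<Longrightarrow> fdet m A > 0"
  shows "\<exists>L. (\<forall>i<N. \<forall>j<N. A i j = (\<Sum>l<N. L i l * L j l)) \<and> (\<forall>i l. i < l \<longrightarrow> L i l = 0)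
    \<and> (\<forall>i<N. L i i > 0)"
  using assms
proof (induction N arbitrary: A)
  case 0
  then show ?case by (intro exI[of _ "\<lambda>_ _. 0"]) auto
next
  case (Suc N)
  have a: "A 0 0 > 0" using Suc.prems(2)[of 1] by simp
  define A' where "A' i j = A (Suc i) (Suc j) - A (Suc i) 0 * A 0 (Suc j) / A 0 0" for i j
  have "\<exists>L. (\<forall>i<N. \<forall>j<N. A' i j = (\<Sum>l<N. L i l * L j l)) \<and> (\<forall>i l. i < l \<longrightarrow> L i l = 0)
      \<and> (\<forall>i<N. L i i > 0)"
  proof (rule Suc.IH)
    show "A' i j = A' j i" if "i < N" "j < N" for i j
      using Suc.prems(1)[of "Suc i" "Suc j"] Suc.prems(1)[of "Suc i" 0] Suc.prems(1)[of 0 "Suc j"] that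
      by (simp add: A'_def)
    show "fdet m A' > 0" if "m \<le> N" for m
    proof -
      have "fdet (Suc m) A = A 0 0 * fdet m A'"
        unfolding A'_def by (rule fdet_schur) (use a in simp)
      then show ?thesis
        using Suc.prems(2)[of "Suc m"] that a by (simp add: zero_less_mult_iff)
    qed
  qed
  then obtain L where "\<forall>i<N. \<forall>j<N. A' i j = (\<Sum>l<N. L i l * L j l)"
    "\<forall>i l. i < l \<longrightarrow> L i l = 0" "\<forall>i<N. L i i > 0"
    by (elim exE conjE)
  then have L: "\<And>i j. i < N \<Longrightarrow> j < N \<Longrightarrow> A' i j = (\<Sum>l<N. L i l * L j l)"
    "\<And>i l. i < l \<Longrightarrow> L i l = 0" "\<And>i. i < N \<Longrightarrow> L i i > 0"
    by simp_all
  \<comment> \<open>The factor of the complement is bordered by column 0 of \<open>A\<close>, scaled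
    so that its outer product is the term subtracted in \<open>A'\<close>.\<close>
  define K where "K i l = (if l = 0 then A i 0 / sqrt (A 0 0)
    else if i = 0 then 0 else L (i - 1) (l - 1))" for i l
  have K: "(\<Sum>l<Suc N. K i l * K j l) = A i 0 * A j 0 / A 0 0 +
      (if i = 0 \<or> j = 0 then 0 else \<Sum>l<N. L (i - 1) l * L (j - 1) l)" for i j
    unfolding sum.lessThan_Suc_shift using a by (simp add: K_def)
  have "A i j = (\<Sum>l<Suc N. K i l * K j l)" if "i < Suc N" "j < Suc N" for i j
  proof (cases "i = 0 \<or> j = 0")
    case True
    then show ?thesis using Suc.prems(1)[OF that] a K[of i j] by auto
  next
    case False
    then obtain i' j' where ij: "i = Suc i'" "j = Suc j'" by (metis not0_implies_Suc)
    then show ?thesis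
      using L(1)[of i' j'] that Suc.prems(1)[of 0 j] K[of i j] by (simp add: A'_def)
  qed
  moreover have "K i l = 0" if "i < l" for i l
    using that L(2)[of "i - 1" "l - 1"] by (auto simp: K_def)
  moreover have "K i i > 0" if "i < Suc N" for i
    using that a L(3)[of "i - 1"] by (auto simp: K_def)
  ultimately show ?case by (intro exI[of _ K] conjI allI impI)
qed

text \<open>With \<open>A = L L\<^sup>T\<close>, the matrix below is the Gram matrix of the rows of a block of the compound
  of \<open>L\<close>, which inherits the triangular shape of \<open>L\<close>.\<close>

lemma fdet_contiguous_compound_pos:
  fixes A :: "nat \<Rightarrow> nat \<Rightarrow> real"
  assumes sym: "\<And>i j. i < N \<Longrightarrow> j < N \<Longrightarrow> A i j = A j i"
    and pos: "\<And>m. m \<le> N \<Longrightarrow> fdet m A > 0"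
    and "0 < k" and N: "r + k \<le> Suc N"
  shows "fdet r (\<lambda>i j. fdet k (\<lambda>p q. A (i + p) (j + q))) > 0"
proof -
  have "\<exists>L. (\<forall>i<N. \<forall>j<N. A i j = (\<Sum>l<N. L i l * L j l)) \<and> (\<forall>i l. i < l \<longrightarrow> L i l = 0)
      \<and> (\<forall>i<N. L i i > 0)"
    by (rule cholesky) (fact sym, fact pos)
  then obtain L where "\<forall>i<N. \<forall>j<N. A i j = (\<Sum>l<N. L i l * L j l)"
    "\<forall>i l. i < l \<longrightarrow> L i l = 0" "\<forall>i<N. L i i > 0"
    by (elim exE conjE)
  then have L: "\<And>i j. i < N \<Longrightarrow> j < N \<Longrightarrow> A i j = (\<Sum>l<N. L i l * L j l)"
    "\<And>i l. i < l \<Longrightarrow> L i l = 0" "\<And>i. i < N \<Longrightarrow> L i i > 0"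
    by simp_all
  \<comment> \<open>The square root spreads the overcount \<open>fact k\<close> of the Cauchy--Binet
    sum evenly over the two factors.\<close>
  define W where "W i \<phi> = fdet k (\<lambda>p q. L (i + p) (\<phi> q)) / sqrt (fact k)" for i and \<phi> :: "nat \<Rightarrow> nat"
  let ?S = "{0..<k} \<rightarrow>\<^sub>E {..<N}"
  have W: "fdet k (\<lambda>p q. A (i + p) (j + q)) = (\<Sum>\<phi>\<in>?S. W i \<phi> * W j \<phi>)" if "i < r" "j < r" for i j
  proof -
    have "fdet k (\<lambda>p q. A (i + p) (j + q)) = fdet k (\<lambda>p q. \<Sum>l<N. L (i + p) l * L (j + q) l)"
      by (rule fdet_cong) (use L(1) that N in auto)
    then have "fact k * fdet k (\<lambda>p q. A (i + p) (j + q)) =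
        (\<Sum>\<phi>\<in>?S. fdet k (\<lambda>p q. L (i + p) (\<phi> q)) * fdet k (\<lambda>p q. L (j + p) (\<phi> q)))"
      by (simp add: fact_mult_fdet_gram)
    also have "\<dots> = (\<Sum>\<phi>\<in>?S. fact k * (W i \<phi> * W j \<phi>))"
      by (intro sum.cong refl) (simp add: W_def)
    finally show ?thesis unfolding sum_distrib_left[symmetric] by simp
  qed
  \<comment> \<open>The nonzero minor is found at the column sets \<open>j, ..., j + k - 1\<close>;
    the values \<open>undefined\<close> put the maps into the extensional function spaces.\<close>
  define \<Phi> where "\<Phi> j = (if j < r then restrict (\<lambda>q. j + q) {0..<k} else undefined)" for j
  have W\<Phi>: "W i (\<Phi> j) = fdet k (\<lambda>p q. L (i + p) (j + q)) / sqrt (fact k)" if "j < r" for i j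
  proof -
    have "fdet k (\<lambda>p q. L (i + p) (\<Phi> j q)) = fdet k (\<lambda>p q. L (i + p) (j + q))"
      by (rule fdet_cong) (use that in \<open>simp add: \<Phi>_def\<close>)
    then show ?thesis by (simp add: W_def)
  qed
  have "fdet r (\<lambda>i j. W i (\<Phi> j)) = (\<Prod>i<r. W i (\<Phi> i))"
  proof (rule fdet_lower_triangular)
    fix i j assume "i < j" "j < r"
    \<comment> \<open>The top row consists of the entries \<open>L i (j + q)\<close>, all strictly
      above the diagonal.\<close>
    then have "fdet k (\<lambda>p q. L (i + p) (j + q)) = 0"
      by (intro fdet_zero_row[of 0]) (use \<open>0 < k\<close> L(2) in auto)
    then show "W i (\<Phi> j) = 0" using \<open>j < r\<close> by (simp add: W\<Phi>)
  qed
  also have "\<dots> \<noteq> 0"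
  proof -
    have "W i (\<Phi> i) \<noteq> 0" if "i < r" for i
    proof -
      have "fdet k (\<lambda>p q. L (i + p) (i + q)) = (\<Prod>p<k. L (i + p) (i + p))"
        by (rule fdet_lower_triangular) (simp add: L(2))
      also have "\<dots> > 0" by (rule prod_pos) (use L(3) that N in auto)
      finally show ?thesis using that by (simp add: W\<Phi>)
    qed
    then show ?thesis by auto
  qed
  finally have nz: "fdet r (\<lambda>i j. W i (\<Phi> j)) \<noteq> 0" .
  have "fdet r (\<lambda>i j. \<Sum>\<phi>\<in>?S. W i \<phi> * W j \<phi>) > 0"
    by (rule fdet_gram_pos[where U = W and \<Phi> = \<Phi>, OF _ _ nz]) (use N in \<open>auto simp: \<Phi>_def intro!: finite_PiE\<close>)
  moreover have "fdet r (\<lambda>i j. fdet k (\<lambda>p q. A (i + p) (j + q))) = fdet r (\<lambda>i j. \<Sum>\<phi>\<in>?S. W i \<phi> * W j \<phi>)"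
    by (rule fdet_cong) (rule W)
  ultimately show ?thesis by simp
qed

section \<open>Minors as submatrices\<close>

lemma pick_atLeastLessThan:
  assumes "p < m"
  shows "pick {i..<i + m} p = i + p"
proof -
  have "{a \<in> {i..<i + m}. a < i + p} = {i..<i + p}" using assms by auto
  then have "card {a \<in> {i..<i + m}. a < i + p} = p" by simp
  then show ?thesis
    using pick_card_in_set[of "i + p" "{i..<i + m}"] assms by simp
qed

lemma det_submatrix:
  assumes "I \<subseteq> {..<dim_row A}" "J \<subseteq> {..<dim_col A}" "card I = card J"
  shows "det (submatrix A I J) = fdet (card I) (\<lambda>i j. A $$ (pick I i, pick J j))"
proof -
  have "{i. i < dim_row A \<and> i \<in> I} = I" "{j. j < dim_col A \<and> j \<in> J} = J"
    using assms by auto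
  then show ?thesis by (simp add: submatrix_def fdet_def assms(3))
qed

lemma totally_positive_contiguous:
  assumes "totally_positive A" "i + m \<le> dim_row A" "j + m \<le> dim_col A"
  shows "fdet m (\<lambda>p q. A $$ (i + p, j + q)) > 0"
\<comment> \<open>Total positivity speaks of nonempty index sets only; the empty determinant is
  1.\<close>
proof (cases "m = 0")
  case False
  let ?I = "{i..<i + m}" and ?J = "{j..<j + m}"
  have sub: "?I \<subseteq> {..<dim_row A}" "?J \<subseteq> {..<dim_col A}" using assms(2,3) by auto
  have "?I \<noteq> {}" "card ?I = card ?J" using False by auto
  then have "det (submatrix A ?I ?J) > 0"
    using assms(1) sub unfolding totally_positive_def by blast
  also have "det (submatrix A ?I ?J) = fdet m (\<lambda>p q. A $$ (pick ?I p, pick ?J q))"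
    using det_submatrix[OF sub] by simp
  also have "\<dots> = fdet m (\<lambda>p q. A $$ (i + p, j + q))"
    by (rule fdet_cong) (simp add: pick_atLeastLessThan)
  finally show ?thesis .
qed simp

lemma increasing_pick:
  assumes "I \<subseteq> {..<N}"
  shows "increasing (card I) N (pick I)"
  using assms pick_in_set[of _ I] pick_mono[of _ I] by (fastforce simp: increasing_def)

text \<open>Fekete's criterion, with \<open>pick\<close> enumerating the chosen rows and columns in
  increasing order.\<close>

lemma totally_positive_iff_contiguous:
  "totally_positive A \<longleftrightarrow> (\<forall>m i j. i + m \<le> dim_row A \<longrightarrow> j + m \<le> dim_col A
     \<longrightarrow> fdet m (\<lambda>p q. A $$ (i + p, j + q)) > 0)" (is "_ \<longleftrightarrow> ?R")
proof
  assume ?R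
  show "totally_positive A"
    unfolding totally_positive_def
  proof (intro allI impI, elim conjE)
    fix I J
    assume IJ: "I \<subseteq> {..<dim_row A}" "J \<subseteq> {..<dim_col A}" "card I = card J"
    have "fdet (card I) (\<lambda>i j. A $$ (pick I i, pick J j)) > 0"
      using fekete[where X = "\<lambda>i j. A $$ (i, j)" and f = "pick I" and g = "pick J" and m = "card I"]
        \<open>?R\<close> increasing_pick[OF IJ(1)] increasing_pick[OF IJ(2)] IJ(3) by metis
    then show "det (submatrix A I J) > 0" by (simp add: det_submatrix[OF IJ])
  qed
qed (blast intro: totally_positive_contiguous)

section \<open>Condensation of Hankel matrices\<close>

text \<open>The contiguous minor of order \<open>m\<close> of the Hankel matrix from row
  \<open>i\<close> and column \<open>j\<close> on, for any \<open>i + j = s\<close>. That only the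
  sum matters is what makes the condensations Hankel.\<close>

definition hankel_minor :: "(nat \<Rightarrow> real) \<Rightarrow> nat \<Rightarrow> nat \<Rightarrow> real" where
  "hankel_minor a m s = fdet m (\<lambda>p q. a (s + p + q))"

text \<open>In Desnanot--Jacobi the two off-diagonal minors both have offset \<open>s + 1\<close>,
  whence the square.\<close>

lemma hankel_minor_condense:
  "hankel_minor a k (s + 2) * hankel_minor a (Suc (Suc k)) s =
    hankel_minor a (Suc k) s * hankel_minor a (Suc k) (s + 2) - (hankel_minor a (Suc k) (s + 1))\<^sup>2"
  using desnanot_jacobi[of k "\<lambda>p q. a (s + p + q)"]
  by (simp add: hankel_minor_def power2_eq_square numeral_2_eq_2)

lemma hankel_minor_pos:
  assumes "totally_positive (hankel_mat n a)" "m \<le> Suc n" "s + 2 * m \<le> 2 * n + 2"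
  shows "hankel_minor a m s > 0"
proof -
  \<comment> \<open>The offset is split between rows and columns: the rows take as much as fits, and
    the bound on \<open>s\<close> makes the rest fit into the columns.\<close>
  define i where "i = min s (Suc n - m)"
  have i: "i + m \<le> Suc n" "(s - i) + m \<le> Suc n" "i \<le> s"
    using assms(2,3) by (auto simp: i_def)
  have "fdet m (\<lambda>p q. hankel_mat n a $$ (i + p, (s - i) + q)) > 0"
    by (rule totally_positive_contiguous[OF assms(1)]) (use i in \<open>auto simp: hankel_mat_def\<close>)
  also have "fdet m (\<lambda>p q. hankel_mat n a $$ (i + p, (s - i) + q)) = hankel_minor a m s"
    unfolding hankel_minor_def by (rule fdet_cong) (use i in \<open>auto simp: hankel_mat_def algebra_simps\<close>)
  finally show ?thesis .
qed

text \<open>Induction along the two-step recursion. Total positivity makes each divisor a positive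
  minor, so that the Desnanot--Jacobi identity can be solved for the larger minor.\<close>

lemma dodgson_hankel_mat:
  assumes "totally_positive (hankel_mat n a)" "k \<le> n"
  shows "dodgson k (hankel_mat n a) = hankel_mat (n - k) (hankel_minor a (Suc k))"
  using assms(2)
proof (induction k "hankel_mat n a" rule: dodgson.induct)
  case 1
  show ?case by (simp add: hankel_mat_def hankel_minor_def)
next
  case 2
  show ?case
  proof (rule eq_matI)
    fix i j
    assume "i < dim_row (hankel_mat (n - Suc 0) (hankel_minor a (Suc (Suc 0))))"
      and "j < dim_col (hankel_mat (n - Suc 0) (hankel_minor a (Suc (Suc 0))))"
    then have ij: "i < n" "j < n" using 2 by (auto simp: hankel_mat_def)
    then show "dodgson (Suc 0) (hankel_mat n a) $$ (i, j) =
        hankel_mat (n - Suc 0) (hankel_minor a (Suc (Suc 0))) $$ (i, j)"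
      \<comment> \<open>The first condensation has no division: the inner minor has order 0 and
        equals 1.\<close>
      using hankel_minor_condense[of a 0 "i + j"]
      by (simp add: hankel_mat_def hankel_minor_def power2_eq_square)
  qed (use 2 in \<open>auto simp: hankel_mat_def\<close>)
next
  case (3 k)
  have M: "dodgson (Suc k) (hankel_mat n a) = hankel_mat (n - Suc k) (hankel_minor a (Suc (Suc k)))"
    and D: "dodgson k (hankel_mat n a) = hankel_mat (n - k) (hankel_minor a (Suc k))"
    using 3 by simp_all
  show ?case
  proof (rule eq_matI)
    fix i j
    let ?h = "hankel_minor a"
    assume "i < dim_row (hankel_mat (n - Suc (Suc k)) (?h (Suc (Suc (Suc k)))))"
      and "j < dim_col (hankel_mat (n - Suc (Suc k)) (?h (Suc (Suc (Suc k)))))"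
    then have ij: "i + k + 1 < n" "j + k + 1 < n" using 3 by (auto simp: hankel_mat_def)
    \<comment> \<open>This is the divisor, the entry \<open>(i + 1, j + 1)\<close> of the matrix two
      steps back.\<close>
    then have "?h (Suc k) (i + j + 2) > 0"
      by (intro hankel_minor_pos[OF assms(1)]) auto
    then have "?h (Suc (Suc (Suc k))) (i + j) =
        (?h (Suc (Suc k)) (i + j) * ?h (Suc (Suc k)) (i + j + 2) - (?h (Suc (Suc k)) (i + j + 1))\<^sup>2)
          / ?h (Suc k) (i + j + 2)"
      using hankel_minor_condense[of a "Suc k" "i + j"] by (simp add: field_simps)
    then show "dodgson (Suc (Suc k)) (hankel_mat n a) $$ (i, j) =
        hankel_mat (n - Suc (Suc k)) (?h (Suc (Suc (Suc k)))) $$ (i, j)"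
      using ij unfolding dodgson.simps M D Let_def
      by (simp add: hankel_mat_def power2_eq_square)
  qed (use 3 in \<open>auto simp: hankel_mat_def Let_def\<close>)
qed

text \<open>A contiguous block at \<open>(i, j)\<close> is a block of the compound of order
  \<open>k + 1\<close> of the symmetric matrix with entries \<open>a (i + j + p + q)\<close>, whose
  leading principal minors are contiguous minors of the given Hankel matrix.\<close>

lemma totally_positive_hankel_minor:
  assumes tp: "totally_positive (hankel_mat n a)" and "k \<le> n"
  shows "totally_positive (hankel_mat (n - k) (hankel_minor a (Suc k)))"
  unfolding totally_positive_iff_contiguous
proof (intro allI impI)
  fix r i j
  let ?B = "hankel_mat (n - k) (hankel_minor a (Suc k))"
  assume "i + r \<le> dim_row ?B" "j + r \<le> dim_col ?B"
  then have ij: "i + r \<le> Suc (n - k)" "j + r \<le> Suc (n - k)" by (auto simp: hankel_mat_def)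
  have "fdet r (\<lambda>p q. ?B $$ (i + p, j + q)) =
      fdet r (\<lambda>p q. fdet (Suc k) (\<lambda>p' q'. a (i + j + (p + p') + (q + q'))))"
    by (rule fdet_cong) (use ij in \<open>auto simp: hankel_mat_def hankel_minor_def algebra_simps\<close>)
  also have "\<dots> > 0"
  \<comment> \<open>Windows of length \<open>k + 1\<close> starting at \<open>0, ..., r - 1\<close>
    occupy \<open>r + k\<close> indices.\<close>
  proof (rule fdet_contiguous_compound_pos[where N = "r + k"])
    show "fdet m (\<lambda>p q. a (i + j + p + q)) > 0" if "m \<le> r + k" for m
      using hankel_minor_pos[OF tp, of m "i + j"] that ij \<open>k \<le> n\<close> by (simp add: hankel_minor_def)
  qed (auto simp: algebra_simps)
  finally show "fdet r (\<lambda>p q. ?B $$ (i + p, j + q)) > 0" .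
qed

theorem theorem3:
  fixes a :: "nat \<Rightarrow> real" and n :: nat
  assumes "totally_positive (hankel_mat n a)"
  shows "\<forall>k\<in>{1..n}. is_hankel (dodgson k (hankel_mat n a))
                    \<and> totally_positive (dodgson k (hankel_mat n a))"
proof
  fix k assume "k \<in> {1..n}"
  then have "k \<le> n" by simp
  then show "is_hankel (dodgson k (hankel_mat n a))
      \<and> totally_positive (dodgson k (hankel_mat n a))"
    using dodgson_hankel_mat[OF assms] totally_positive_hankel_minor[OF assms]
    by (auto simp: is_hankel_def)
qed

end
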